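(* For every integer $k$ and every real number $\alpha>0$ there exists $\beta>0$ such that the following holds. Let $H$ be a set of $2k+1$ closed halfspaces in $\mathbb{R}^d$, let $P$ be a monotone property of $H$-convex sets, and let $\mathcal{B}$ be a finite family of $H$-convex sets in $\mathbb{R}^d$. If at least $\alpha\binom{|\mathcal{B}|}{k+1}$ of the $(k+1)$-tuples (subfamilies of size $k+1$) in $\mathcal{B}$ are $P$-intersecting, then there exists a $P$-intersecting subfamily $\mathcal{B}'\subseteq\mathcal{B}$ of size at least $\beta|\mathcal{B}|$.
   Context: Let $H=\{H_1,\dots,H_m\}$ be a set of $m$ closed halfspaces in $\mathbb{R}^d$. An $H$-convex set $B$ in $\mathbb{R}^d$ is an intersection of $m$ halfspaces $H_1^B,\dots,H_m^B$ such that for each $i$ the halfspace $H_i^B$ is a translate of $H_i$. Intersections of nonempty finite families of $H$-convex sets are $H$-convex. A property $P$ of $H$-convex sets (a class of $H$-convex sets) is monotone if $B\in P$ and $B\subseteq C$ imply $C\in P$ for all $H$-convex sets $B,C$. A family of $H$-convex sets is $P$-intersecting if the intersection of its members has property $P$.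
   Formalization: The family is additionally assumed to have at least k+1 members; with fewer members there are no (k+1)-tuples, the density condition is vacuous, and the claim fails, for instance when P is the empty property. *)

theory Defs
  imports Jordan_Normal_Form.Matrix
begin

text \<open>
  The constant of the theorem must not depend on the dimension, so the dimension has to be
  quantified inside the statement. Hence Euclidean \<open>d\<close>-space is \<open>carrier_vec d :: real vec set\<close>
  rather than a type.
\<close>

definition closed_halfspace :: "nat \<Rightarrow> real vec set \<Rightarrow> bool" where
  "closed_halfspace d h \<longleftrightarrow>
     (\<exists>a\<in>carrier_vec d. \<exists>b. a \<noteq> 0\<^sub>v d \<and> h = {x \<in> carrier_vec d. a \<bullet> x \<le> b})"

definition translate_of :: "nat \<Rightarrow> real vec set \<Rightarrow> real vec set \<Rightarrow> bool" where
  "translate_of d h h' \<longleftrightarrow> (\<exists>v\<in>carrier_vec d. h' = (\<lambda>x. x + v) ` h)"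

text \<open>
  \<open>T h\<close> is the translate of \<open>h\<close> chosen for \<open>B\<close>; it need not be determined by \<open>B\<close>. Intersecting
  with \<open>carrier_vec d\<close> only matters for \<open>H = {}\<close>, where the intersection is the whole space.
\<close>

definition H_convex :: "nat \<Rightarrow> real vec set set \<Rightarrow> real vec set \<Rightarrow> bool" where
  "H_convex d H B \<longleftrightarrow>
     (\<exists>T. (\<forall>h\<in>H. translate_of d h (T h)) \<and> B = carrier_vec d \<inter> (\<Inter>h\<in>H. T h))"

definition monotone_property :: "nat \<Rightarrow> real vec set set \<Rightarrow> real vec set set \<Rightarrow> bool" where
  "monotone_property d H P \<longleftrightarrow>
     P \<subseteq> {B. H_convex d H B} \<and>
     (\<forall>B C. H_convex d H B \<longrightarrow> H_convex d H C \<longrightarrow> B \<in> P \<longrightarrow> B \<subseteq> C \<longrightarrow> C \<in> P)"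

text \<open>
  Meant for nonempty families: the empty family has intersection \<open>UNIV\<close>, which is not
  \<open>H\<close>-convex and so belongs to no property \<open>P\<close> as above.
\<close>

definition P_intersecting :: "real vec set set \<Rightarrow> real vec set set \<Rightarrow> bool" where
  "P_intersecting P F \<longleftrightarrow> \<Inter>F \<in> P"

end

theory Submission
  imports Defs
begin

text \<open>
  Fix a representation of every member \<open>B\<close> of the family by translates \<open>T B h\<close>, one for each
  \<open>h \<in> H\<close>. Translates of a single halfspace form a chain under inclusion
  (\<open>translates_of_halfspace_chain\<close>), so \<open>B\<close> behaves like a point with \<open>2 * k + 1\<close> coordinates,
  and intersecting sets means taking coordinatewise minima.
  By monotonicity of \<open>P\<close> it suffices to find one \<open>P\<close>-intersecting \<open>(k + 1)\<close>-tuple \<open>F\<close> such that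
  linearly many members of the family lie coordinatewise above the minimum of \<open>F\<close>.

  To find it, note that the \<open>2 * k + 1\<close> minima of a \<open>(k + 1)\<close>-tuple cannot give every element
  of the tuple two coordinates. So some \<open>x\<close> in the tuple is needed for the minimum in at most one
  coordinate \<open>i\<close>: in all others it lies above an element of the rest \<open>F\<^sub>0\<close>
  (\<open>element_minimal_in_at_most_one_coordinate\<close>). Charge the tuple to the pair \<open>(F\<^sub>0, i)\<close>. There are
  only \<open>(2 * k + 1) * (n choose k)\<close> pairs for a positive fraction of the \<open>n choose (k + 1)\<close> tuples,
  hence some pair is charged by a set \<open>S\<close> of linearly many elements \<open>x\<close>. Extending \<open>F\<^sub>0\<close> by the
  \<open>x \<in> S\<close> that is smallest in coordinate \<open>i\<close> gives a tuple whose minimum is below all of \<open>S\<close>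
  (\<open>tuple_below_many\<close>). The resulting constant is \<open>\<beta> = \<alpha> / ((k + 1) * (2 * k + 1))\<close>.
\<close>

section \<open>Tuples in finitely many chains\<close>

lemma finite_chain_has_least:
  fixes t :: "'v \<Rightarrow> 'a::order"
  assumes "finite S" "S \<noteq> {}"
    and total: "\<And>x y. x \<in> S \<Longrightarrow> y \<in> S \<Longrightarrow> t x \<le> t y \<or> t y \<le> t x"
  shows "\<exists>x\<in>S. \<forall>y\<in>S. t x \<le> t y"
proof -
  obtain m where m: "m \<in> t ` S" "\<forall>b\<in>t ` S. b \<le> m \<longrightarrow> m = b"
    using finite_has_minimal[of "t ` S"] assms(1,2) by auto
  then obtain x where "x \<in> S" "m = t x" by blast
  then show ?thesis using m total by (metis imageI order_refl)
qed

text \<open>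
  Double counting of the pairs formed by a coordinate and a chosen element attaining its minimum:
  two coordinates for each of the \<open>k + 1\<close> elements would be one coordinate too many.
\<close>

lemma element_minimal_in_at_most_one_coordinate:
  fixes t :: "'i \<Rightarrow> 'v \<Rightarrow> 'a::order"
  assumes I: "card I = 2 * k + 1" and F: "card F = k + 1"
    and total: "\<And>i x y. i \<in> I \<Longrightarrow> x \<in> F \<Longrightarrow> y \<in> F \<Longrightarrow> t i x \<le> t i y \<or> t i y \<le> t i x"
  shows "\<exists>x\<in>F. \<exists>i\<in>I. \<forall>j\<in>I - {i}. \<exists>f\<in>F - {x}. t j f \<le> t j x"
proof -
  have fin: "finite F" "F \<noteq> {}" "finite I" "I \<noteq> {}"
    using F I by (auto intro: card_ge_0_finite)
  have "\<forall>j\<in>I. \<exists>m\<in>F. \<forall>y\<in>F. t j m \<le> t j y"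
    using finite_chain_has_least[OF fin(1,2)] total by blast
  then obtain m where m: "\<And>j. j \<in> I \<Longrightarrow> m j \<in> F" "\<And>j y. j \<in> I \<Longrightarrow> y \<in> F \<Longrightarrow> t j (m j) \<le> t j y"
    by metis
  define N where "N x = {j \<in> I. m j = x}" for x
  obtain x where x: "x \<in> F" "card (N x) \<le> 1"
  proof (rule ccontr)
    assume "\<not> thesis"
    then have "\<And>x. x \<in> F \<Longrightarrow> 2 \<le> card (N x)"
      using that by force
    then have "card F * 2 \<le> (\<Sum>x\<in>F. card (N x))"
      using sum_bounded_below[of F 2 "\<lambda>x. card (N x)"] by simp
    also have "\<dots> = card (\<Union>x\<in>F. N x)"
      by (rule card_UN_disjoint[symmetric]) (use fin in \<open>auto simp: N_def\<close>)
    also have "(\<Union>x\<in>F. N x) = I"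
      using m(1) by (auto simp: N_def)
    finally show False using I F by simp
  qed
  have "finite (N x)" using fin by (simp add: N_def)
  then obtain i where i: "i \<in> I" "N x \<subseteq> {i}"
  proof (cases "N x = {}")
    case True
    then show ?thesis using that fin by blast
  next
    case False
    then obtain i where "i \<in> N x" by blast
    moreover have "N x \<subseteq> {i}"
      using x(2) \<open>i \<in> N x\<close> \<open>finite (N x)\<close> card_le_Suc0_iff_eq by fastforce
    ultimately show ?thesis using that by (auto simp: N_def)
  qed
  have "\<exists>f\<in>F - {x}. t j f \<le> t j x" if "j \<in> I - {i}" for j
    using that m x(1) i(2) by (intro bexI[of _ "m j"]) (auto simp: N_def)
  then show ?thesis using x(1) i(1) by blast
qed

text \<open>
  The combinatorial core, for arbitrary chains in place of translates: a dense family of tuples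
  contains one whose coordinatewise minimum is below many elements. The tuple itself
  belongs to the set \<open>W\<close> of those elements, which accounts for the summand \<open>k\<close>.
\<close>

lemma tuple_below_many:
  fixes t :: "'i \<Rightarrow> 'v \<Rightarrow> 'a::order"
  assumes I: "card I = 2 * k + 1" and V: "finite V"
    and total: "\<And>i x y. i \<in> I \<Longrightarrow> x \<in> V \<Longrightarrow> y \<in> V \<Longrightarrow> t i x \<le> t i y \<or> t i y \<le> t i x"
    and G: "\<And>F. F \<in> G \<Longrightarrow> F \<subseteq> V \<and> card F = k + 1" "G \<noteq> {}"
  shows "\<exists>F\<in>G. \<exists>W\<subseteq>V. F \<subseteq> W \<and> (\<forall>i\<in>I. \<forall>b\<in>W. \<exists>f\<in>F. t i f \<le> t i b) \<and>
           card G \<le> (card V choose k) * (2 * k + 1) * (card W - k)"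
proof -
  define K where "K = {A. A \<subseteq> V \<and> card A = k} \<times> I"
  \<comment> \<open>The elements \<open>x\<close> for which the tuple \<open>insert x A\<close> may be charged to \<open>(A, i)\<close>.\<close>
  define S where "S = (\<lambda>(A, i). {x \<in> V - A. insert x A \<in> G \<and>
                       (\<forall>j\<in>I - {i}. \<exists>f\<in>A. t j f \<le> t j x)})"
  have finI: "finite I" using I by (simp add: card_ge_0_finite)
  have finK: "finite K" using V finI by (simp add: K_def)
  have cardK: "card K = (card V choose k) * (2 * k + 1)"
    using V I by (simp add: K_def card_cartesian_product n_subsets)
  have finS: "finite (S p)" for p using V by (cases p) (simp add: S_def)
  have cover: "G \<subseteq> (\<Union>p\<in>K. (\<lambda>x. insert x (fst p)) ` S p)"
  proof
    fix F assume "F \<in> G"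
    then have F: "F \<subseteq> V" "card F = k + 1" using G(1) by auto
    obtain x i where xi: "x \<in> F" "i \<in> I" "\<forall>j\<in>I - {i}. \<exists>f\<in>F - {x}. t j f \<le> t j x"
      using element_minimal_in_at_most_one_coordinate[OF I F(2), of t] total F(1) by blast
    have "(F - {x}, i) \<in> K" using F xi by (auto simp: K_def)
    moreover have "x \<in> S (F - {x}, i)" "insert x (F - {x}) = F"
      using F xi \<open>F \<in> G\<close> by (auto simp: S_def insert_absorb)
    ultimately show "F \<in> (\<Union>p\<in>K. (\<lambda>x. insert x (fst p)) ` S p)" by force
  qed
  then have "K \<noteq> {}" using G(2) by auto
  then obtain p where p: "p \<in> K" "card (S p) = Max ((\<lambda>p. card (S p)) ` K)"
    using obtains_MAX[OF finK] by metis
  have "card G \<le> card (\<Union>p\<in>K. (\<lambda>x. insert x (fst p)) ` S p)"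
    using cover finK finS by (intro card_mono) auto
  also have "\<dots> \<le> (\<Sum>p\<in>K. card ((\<lambda>x. insert x (fst p)) ` S p))"
    by (rule card_UN_le[OF finK])
  also have "\<dots> \<le> (\<Sum>q\<in>K. card (S p))"
  proof (rule sum_mono)
    fix q assume "q \<in> K"
    have "card ((\<lambda>x. insert x (fst q)) ` S q) \<le> card (S q)"
      by (rule card_image_le[OF finS])
    also have "\<dots> \<le> card (S p)" using p(2) finK \<open>q \<in> K\<close> by simp
    finally show "card ((\<lambda>x. insert x (fst q)) ` S q) \<le> card (S p)" .
  qed
  finally have bound: "card G \<le> (card V choose k) * (2 * k + 1) * card (S p)"
    by (simp add: cardK)
  have "finite G"
    by (rule finite_subset[of _ "Pow V"]) (use G(1) V in auto)
  then have "card G \<noteq> 0" using G(2) by simp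
  then have "S p \<noteq> {}" using bound by auto
  obtain A i where p_eq: "p = (A, i)" and A: "A \<subseteq> V" "card A = k" and "i \<in> I"
    using p(1) by (auto simp: K_def)
  have SV: "S p \<subseteq> V" and disj: "S p \<inter> A = {}" by (auto simp: S_def p_eq)
  obtain x where x: "x \<in> S p" "\<forall>y\<in>S p. t i x \<le> t i y"
    using finite_chain_has_least[OF finS \<open>S p \<noteq> {}\<close>, of "t i"] total \<open>i \<in> I\<close> SV by blast
  have "insert x A \<in> G" using x(1) by (auto simp: S_def p_eq)
  moreover have "\<exists>f\<in>insert x A. t j f \<le> t j b" if "j \<in> I" "b \<in> S p \<union> A" for j b
  proof (cases "b \<in> A")
    case False
    then have "b \<in> S p" using that by simp
    then show ?thesis using x(2) \<open>j \<in> I\<close> by (cases "j = i") (auto simp: S_def p_eq)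
  qed auto
  moreover have "card (S p \<union> A) - k = card (S p)"
    using card_Un_disjoint[OF finS _ disj] A V finite_subset by fastforce
  ultimately show ?thesis
    using bound x(1) A(1) SV
    by (intro bexI[of _ "insert x A"] exI[of _ "S p \<union> A"]) auto
qed

section \<open>Translates of halfspaces\<close>

text \<open>
  A translate of \<open>{x. a \<bullet> x \<le> b}\<close> has the same normal vector \<open>a\<close>, so it is determined by its
  right-hand side.
\<close>

lemma translates_of_halfspace_chain:
  assumes "closed_halfspace d h" "translate_of d h h1" "translate_of d h h2"
  shows "h1 \<subseteq> h2 \<or> h2 \<subseteq> h1"
proof -
  obtain a b where a: "a \<in> carrier_vec d" and h: "h = {x \<in> carrier_vec d. a \<bullet> x \<le> b}"
    using assms(1) unfolding closed_halfspace_def by blast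
  have sublevel: "\<exists>c. g = {x \<in> carrier_vec d. a \<bullet> x \<le> c}" if g_trans: "translate_of d h g" for g
  proof -
    obtain v where v: "v \<in> carrier_vec d" and g: "g = (\<lambda>x. x + v) ` h"
      using g_trans unfolding translate_of_def by blast
    have "g = {x \<in> carrier_vec d. a \<bullet> x \<le> b + a \<bullet> v}"
    proof (intro equalityI subsetI)
      fix y assume "y \<in> g"
      then show "y \<in> {x \<in> carrier_vec d. a \<bullet> x \<le> b + a \<bullet> v}"
        using a v by (auto simp: g h scalar_prod_add_distrib)
    next
      fix y assume y: "y \<in> {x \<in> carrier_vec d. a \<bullet> x \<le> b + a \<bullet> v}"
      then have "y - v \<in> h"
        using a v by (auto simp: h scalar_prod_minus_distrib)
      moreover have "y = (y - v) + v" using y v by auto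
      ultimately show "y \<in> g" unfolding g by blast
    qed
    then show ?thesis by blast
  qed
  obtain c1 c2 where c1: "h1 = {x \<in> carrier_vec d. a \<bullet> x \<le> c1}"
    and c2: "h2 = {x \<in> carrier_vec d. a \<bullet> x \<le> c2}"
    using sublevel[OF assms(2)] sublevel[OF assms(3)] by blast
  show ?thesis unfolding c1 c2 by (cases "c1 \<le> c2") auto
qed

lemma H_convex_Inter:
  assumes hs: "\<forall>h\<in>H. closed_halfspace d h"
    and "finite W" "W \<noteq> {}" and W: "\<forall>B\<in>W. H_convex d H B"
  shows "H_convex d H (\<Inter>W)"
proof -
  obtain T where T: "\<And>B h. B \<in> W \<Longrightarrow> h \<in> H \<Longrightarrow> translate_of d h (T B h)"
    and repr: "\<And>B. B \<in> W \<Longrightarrow> B = carrier_vec d \<inter> (\<Inter>h\<in>H. T B h)"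
    using W unfolding H_convex_def by metis
  \<comment> \<open>In a finite chain the intersection is one of the members, hence again a translate.\<close>
  have "translate_of d h (\<Inter>B\<in>W. T B h)" if hH: "h \<in> H" for h
  proof -
    have "T B h \<subseteq> T C h \<or> T C h \<subseteq> T B h" if "B \<in> W" "C \<in> W" for B C
      using translates_of_halfspace_chain hs T hH that by blast
    then obtain C where "C \<in> W" "\<forall>B\<in>W. T C h \<subseteq> T B h"
      using finite_chain_has_least[OF assms(2,3), of "\<lambda>B. T B h"] by blast
    then have "(\<Inter>B\<in>W. T B h) = T C h" by blast
    then show ?thesis using T \<open>C \<in> W\<close> hH by simp
  qed
  moreover have "\<Inter>W = carrier_vec d \<inter> (\<Inter>h\<in>H. \<Inter>B\<in>W. T B h)"
    using repr \<open>W \<noteq> {}\<close> by blast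
  ultimately show ?thesis unfolding H_convex_def by (intro exI[of _ "\<lambda>h. \<Inter>B\<in>W. T B h"]) blast
qed

section \<open>The fractional Helly theorem\<close>

text \<open>
  The arithmetic turning the count of \<open>tuple_below_many\<close> into a linear bound. The ratio
  \<open>(n choose (k + 1)) / (n choose k) = (n - k) / (k + 1)\<close> loses \<open>k\<close>, which the \<open>k\<close> elements
  outside the \<open>s\<close> counted ones compensate because the density \<open>\<alpha>\<close> is at most 1.
\<close>

lemma linear_bound_from_density:
  fixes \<alpha> :: real
  assumes "0 < \<alpha>" "\<alpha> \<le> 1" "k + 1 \<le> n"
    and dens: "\<alpha> * real (n choose (k + 1)) \<le> real ((n choose k) * (2 * k + 1) * s)"
  shows "\<alpha> / real ((k + 1) * (2 * k + 1)) * real n \<le> real (s + k)"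
proof -
  define M where "M = real ((k + 1) * (2 * k + 1))"
  have M: "1 \<le> M" by (simp add: M_def)
  have "(k + 1) * (n choose (k + 1)) = (n - k) * (n choose k)"
    using binomial_absorption[of k n] binomial_absorb_comp[of n k] by simp
  then have ratio: "real (k + 1) * real (n choose (k + 1)) = real (n - k) * real (n choose k)"
    by (metis of_nat_mult)
  have "\<alpha> * real (n - k) * real (n choose k) = real (k + 1) * (\<alpha> * real (n choose (k + 1)))"
    using ratio by (simp add: algebra_simps)
  also have "\<dots> \<le> real (k + 1) * real ((n choose k) * (2 * k + 1) * s)"
    by (rule mult_left_mono[OF dens]) simp
  also have "\<dots> = (M * real s) * real (n choose k)"
    by (simp add: M_def algebra_simps)
  finally have "\<alpha> * real (n - k) \<le> M * real s"
    using assms(3) by (simp add: zero_less_binomial_iff)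
  moreover have "\<alpha> * real k \<le> M * real k"
    using assms(2) M by (intro mult_right_mono) auto
  ultimately have "\<alpha> * real n \<le> M * real (s + k)"
    using assms(3) by (simp add: of_nat_diff algebra_simps)
  then have "\<alpha> / M * real n \<le> real (s + k)"
    using M by (simp add: pos_divide_le_eq mult.commute)
  then show ?thesis by (simp only: M_def)
qed

theorem theorem2p3:
  fixes k :: nat and \<alpha> :: real
  assumes "\<alpha> > 0"
  shows "\<exists>\<beta>>0. \<forall>(d::nat) (H :: real vec set set) (P :: real vec set set) (\<B> :: real vec set set).
           card H = 2 * k + 1 \<longrightarrow>
           (\<forall>h\<in>H. closed_halfspace d h) \<longrightarrow>
           monotone_property d H P \<longrightarrow>
           finite \<B> \<longrightarrow>
           (\<forall>B\<in>\<B>. H_convex d H B) \<longrightarrow>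
           k + 1 \<le> card \<B> \<longrightarrow>
           real (card {F. F \<subseteq> \<B> \<and> card F = k + 1 \<and> P_intersecting P F})
             \<ge> \<alpha> * real (card \<B> choose (k + 1)) \<longrightarrow>
           (\<exists>\<B>'\<subseteq>\<B>. P_intersecting P \<B>' \<and> real (card \<B>') \<ge> \<beta> * real (card \<B>))"
proof (intro exI[of _ "\<alpha> / real ((k + 1) * (2 * k + 1))"] conjI allI impI)
  show "0 < \<alpha> / real ((k + 1) * (2 * k + 1))"
    using assms by (intro divide_pos_pos) (simp_all only: of_nat_0_less_iff, simp)
next
  fix d :: nat and H P \<B> :: "real vec set set"
  assume H: "card H = 2 * k + 1" and hs: "\<forall>h\<in>H. closed_halfspace d h"
    and P: "monotone_property d H P" and fin: "finite \<B>"
    and conv: "\<forall>B\<in>\<B>. H_convex d H B" and n: "k + 1 \<le> card \<B>"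
    and dens: "real (card {F. F \<subseteq> \<B> \<and> card F = k + 1 \<and> P_intersecting P F})
             \<ge> \<alpha> * real (card \<B> choose (k + 1))"
  define G where "G = {F. F \<subseteq> \<B> \<and> card F = k + 1 \<and> P_intersecting P F}"
  have pos: "0 < real (card \<B> choose (k + 1))"
    using n by (simp add: zero_less_binomial_iff)
  then have "0 < \<alpha> * real (card \<B> choose (k + 1))" using assms by simp
  then have "0 < real (card G)" using dens unfolding G_def by linarith
  then have "G \<noteq> {}" by auto
  have "card G \<le> card {F. F \<subseteq> \<B> \<and> card F = k + 1}"
    unfolding G_def using fin by (intro card_mono) auto
  then have "card G \<le> card \<B> choose (k + 1)" using n_subsets[OF fin] by simp
  then have "\<alpha> * real (card \<B> choose (k + 1)) \<le> 1 * real (card \<B> choose (k + 1))"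
    using dens by (simp add: G_def)
  then have "\<alpha> \<le> 1" using pos by (rule mult_right_le_imp_le)
  obtain T where T: "\<And>B h. B \<in> \<B> \<Longrightarrow> h \<in> H \<Longrightarrow> translate_of d h (T B h)"
    and repr: "\<And>B. B \<in> \<B> \<Longrightarrow> B = carrier_vec d \<inter> (\<Inter>h\<in>H. T B h)"
    using conv unfolding H_convex_def by metis
  have chain: "T B h \<subseteq> T C h \<or> T C h \<subseteq> T B h" if "h \<in> H" "B \<in> \<B>" "C \<in> \<B>" for h B C
    using translates_of_halfspace_chain hs T that by blast
  obtain F W where F: "F \<in> G" "F \<subseteq> W" and W: "W \<subseteq> \<B>"
    and below: "\<forall>h\<in>H. \<forall>B\<in>W. \<exists>f\<in>F. T f h \<subseteq> T B h"
    and count: "card G \<le> (card \<B> choose k) * (2 * k + 1) * (card W - k)"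
    using tuple_below_many[OF H fin, of "\<lambda>h B. T B h" G] chain \<open>G \<noteq> {}\<close>
    by (auto simp: G_def)
  have FG: "F \<subseteq> \<B>" "card F = k + 1" "\<Inter>F \<in> P"
    using F(1) by (auto simp: G_def P_intersecting_def)
  then have "F \<noteq> {}" by auto
  have finW: "finite W" using W fin finite_subset by blast
  have "H_convex d H (\<Inter>F)" "H_convex d H (\<Inter>W)"
    using H_convex_Inter[OF hs] F(2) W finW conv \<open>F \<noteq> {}\<close>
    by (metis finite_subset subset_empty subset_iff)+
  moreover have "\<Inter>F \<subseteq> \<Inter>W"
  proof
    fix y assume y: "y \<in> \<Inter>F"
    have "y \<in> carrier_vec d" using y \<open>F \<noteq> {}\<close> FG(1) repr by blast
    moreover have "y \<in> T B h" if "B \<in> W" "h \<in> H" for B h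
      using below that y FG(1) repr by blast
    ultimately show "y \<in> \<Inter>W" using repr W by blast
  qed
  ultimately have "P_intersecting P W"
    using P FG(3) unfolding monotone_property_def P_intersecting_def by blast
  moreover have "\<alpha> / real ((k + 1) * (2 * k + 1)) * real (card \<B>) \<le> real (card W)"
  proof -
    have "k \<le> card W" using card_mono[OF finW F(2)] FG(2) by simp
    have "\<alpha> * real (card \<B> choose (k + 1))
        \<le> real ((card \<B> choose k) * (2 * k + 1) * (card W - k))"
      using dens count by (simp only: G_def[symmetric] flip: of_nat_le_iff[where 'a = real])
    from linear_bound_from_density[OF assms \<open>\<alpha> \<le> 1\<close> n this] \<open>k \<le> card W\<close>
    show ?thesis by simp
  qed
  ultimately show "\<exists>\<B>'\<subseteq>\<B>. P_intersecting P \<B>' \<and>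
      real (card \<B>') \<ge> \<alpha> / real ((k + 1) * (2 * k + 1)) * real (card \<B>)"
    using W by blast
qed

end
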